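(* Let $\mu=\mu_{\mathrm{ac}}+\mu_{\mathrm{s}}$ be the Lebesgue decomposition, with respect to $\sigma$, of a non-trivial probability measure $\mu$ on the unit sphere $\partial\mathbb{B}^d\subset\mathbb{C}^d$, with $\mu_{\mathrm{s}}$ discrete. Then for every $z_0\in\mathbb{B}^d$, $$\lambda_\infty^{(d)}(z_0;d\mu)=\lambda_\infty^{(d)}(z_0;d\mu_{\mathrm{ac}}).$$
   Context: $\mathbb{B}^d$ is the open unit ball of $\mathbb{C}^d$ and $\sigma$ is the rotation-invariant Lebesgue probability measure on $\partial\mathbb{B}^d$; $\mu_{\mathrm{ac}}$ is absolutely continuous and $\mu_{\mathrm{s}}$ singular with respect to $\sigma$. A measure is discrete if it is a countable sum $\sum_k\rho_k\delta_{\zeta_k}$ of point masses. A positive measure $\mu$ is non-trivial if the matrix $[\int\zeta^{\alpha'}\overline{\zeta}^{\beta'}d\mu]_{0\preceq\alpha',\beta'\preceq\alpha}$ is invertible for every $\alpha\in\mathbb{N}_0^d$, where $\prec$ is the shortlex order ($\alpha\prec\beta$ if $|\alpha|<|\beta|$, or if $|\alpha|=|\beta|$ and $\alpha_i>\beta_i$ at the first index where they differ); equivalently, no nonzero polynomial $q\in\mathbb{C}[z_1,\dots,z_d]$ satisfies $\int|q|^2d\mu=0$. For a finite positive Borel measure $\nu$ on $\partial\mathbb{B}^d$, the Christoffel function is $$\lambda_\infty^{(d)}(z;d\nu)=\inf\left\{\int_{\partial\mathbb{B}^d}|q(\zeta)|^2\,d\nu(\zeta):\ q\in\mathbb{C}[z_1,\dots,z_d],\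 q(z)=1\right\}.$$ (For a non-trivial probability measure this equals $\lim_n(\sum_{\alpha\preceq(0,\dots,0,n)}|\varphi_\alpha(z)|^2)^{-1}$ with $(\varphi_\alpha)$ the orthonormal polynomials obtained by Gram--Schmidt on the monomials in shortlex order.) *)

theory Defs
  imports "HOL-Probability.Probability" "HOL-Library.Poly_Mapping"
begin

abbreviation sphere_borel :: "'a::euclidean_space measure" where
  "sphere_borel \<equiv> restrict_space borel (sphere 0 1)"

text \<open>
  The normalized Lebesgue measure of the unit sphere is the image of the uniform distribution on the
  unit ball under the radial projection \<open>sgn x = x /\<^sub>R norm x\<close>. (\<open>sgn 0 = 0\<close> lies outside the sphere,
  but the origin is a null set.) For \<open>complex ^ 'd\<close>, the norm and \<open>lborel\<close> are those of the
  underlying real Euclidean space of dimension \<open>2 * CARD('d)\<close>. The lemmas below show that it is a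
  probability measure invariant under all real-orthogonal (in particular all unitary) maps.
\<close>

definition sphere_measure :: "'a::euclidean_space measure" where
  "sphere_measure =
     restrict_space (distr (uniform_measure lborel (ball 0 1)) borel sgn) (sphere 0 1)"

text \<open>\<open>M\<close> is the reference measure: \<open>N\<close> is singular with respect to \<open>M\<close>.\<close>

definition singular_measure :: "'a measure \<Rightarrow> 'a measure \<Rightarrow> bool" where
  "singular_measure M N \<longleftrightarrow>
     (\<exists>A\<in>sets M. emeasure M A = 0 \<and> emeasure N (space M - A) = 0)"

text \<open>\<open>N = Nac + Ns\<close> is the Lebesgue decomposition of \<open>N\<close> with respect to \<open>M\<close>.\<close>

definition lebesgue_decomposition ::
    "'a measure \<Rightarrow> 'a measure \<Rightarrow> 'a measure \<Rightarrow> 'a measure \<Rightarrow> bool" where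
  "lebesgue_decomposition M N Nac Ns \<longleftrightarrow>
     sets N = sets M \<and> sets Nac = sets M \<and> sets Ns = sets M \<and>
     (\<forall>A\<in>sets M. emeasure N A = emeasure Nac A + emeasure Ns A) \<and>
     absolutely_continuous M Nac \<and> singular_measure M Ns"

text \<open>
  Weights \<open>\<rho> k = 0\<close> are allowed, so that finite (and empty) sums of point masses are
  covered. (\<open>suminf\<close> is spelled out because \<open>Poly_Mapping\<close> also reads the sum notation as
  \<open>Sum_any\<close>, which is zero for infinite support.)
\<close>

definition discrete_measure :: "'a measure \<Rightarrow> bool" where
  "discrete_measure M \<longleftrightarrow>
     (\<exists>(\<rho> :: nat \<Rightarrow> real) (\<zeta> :: nat \<Rightarrow> 'a).
        (\<forall>k. 0 \<le> \<rho> k) \<and> (\<forall>k. \<zeta> k \<in> space M) \<and>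
        (\<forall>A\<in>sets M. emeasure M A = suminf (\<lambda>k. ennreal (\<rho> k) * indicator A (\<zeta> k))))"

text \<open>
  The coordinates of \<open>\<complex>\<^sup>d\<close> are indexed by a finite linearly ordered type \<open>'d\<close>; multi-indices are the
  elements of \<open>'d \<Rightarrow>\<^sub>0 nat\<close>, and a polynomial maps multi-indices to coefficients.
\<close>

type_synonym 'd cpoly = "('d \<Rightarrow>\<^sub>0 nat) \<Rightarrow>\<^sub>0 complex"

definition mono_eval :: "('d::finite \<Rightarrow>\<^sub>0 nat) \<Rightarrow> complex ^ 'd \<Rightarrow> complex" where
  "mono_eval \<alpha> z = (\<Prod>i\<in>UNIV. (z $ i) ^ Poly_Mapping.lookup \<alpha> i)"

definition cpoly_eval :: "'d::finite cpoly \<Rightarrow> complex ^ 'd \<Rightarrow> complex" where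
  "cpoly_eval q z = (\<Sum>\<alpha>\<in>Poly_Mapping.keys q. Poly_Mapping.lookup q \<alpha> * mono_eval \<alpha> z)"

definition mdeg :: "('d::finite \<Rightarrow>\<^sub>0 nat) \<Rightarrow> nat" where
  "mdeg \<alpha> = (\<Sum>i\<in>UNIV. Poly_Mapping.lookup \<alpha> i)"

definition shortlex_less :: "('d::{finite,linorder} \<Rightarrow>\<^sub>0 nat) \<Rightarrow> ('d \<Rightarrow>\<^sub>0 nat) \<Rightarrow> bool" where
  "shortlex_less \<alpha> \<beta> \<longleftrightarrow>
     mdeg \<alpha> < mdeg \<beta> \<or>
     mdeg \<alpha> = mdeg \<beta> \<and>
       (\<exists>i. Poly_Mapping.lookup \<alpha> i > Poly_Mapping.lookup \<beta> i \<and>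
            (\<forall>j<i. Poly_Mapping.lookup \<alpha> j = Poly_Mapping.lookup \<beta> j))"

definition shortlex_le :: "('d::{finite,linorder} \<Rightarrow>\<^sub>0 nat) \<Rightarrow> ('d \<Rightarrow>\<^sub>0 nat) \<Rightarrow> bool" where
  "shortlex_le \<alpha> \<beta> \<longleftrightarrow> shortlex_less \<alpha> \<beta> \<or> \<alpha> = \<beta>"

text \<open>
  Two-sided invertibility of the square matrix \<open>(A i j)\<^bsub>i, j \<in> I\<^esub>\<close>. Meaningful for finite \<open>I\<close> only;
  the index sets used below are finite by lemma \<open>finite_shortlex\<close>.
\<close>

definition invertible_matrix_on :: "'i set \<Rightarrow> ('i \<Rightarrow> 'i \<Rightarrow> complex) \<Rightarrow> bool" where
  "invertible_matrix_on I A \<longleftrightarrow>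
     (\<exists>B. \<forall>i\<in>I. \<forall>j\<in>I.
        (\<Sum>k\<in>I. A i k * B k j) = (if i = j then 1 else 0) \<and>
        (\<Sum>k\<in>I. B i k * A k j) = (if i = j then 1 else 0))"

definition nontrivial_measure :: "(complex ^ 'd::{finite,linorder}) measure \<Rightarrow> bool" where
  "nontrivial_measure M \<longleftrightarrow>
     (\<forall>\<alpha> :: 'd \<Rightarrow>\<^sub>0 nat.
        invertible_matrix_on {\<beta>. shortlex_le 0 \<beta> \<and> shortlex_le \<beta> \<alpha>}
          (\<lambda>\<alpha>' \<beta>'. \<integral>\<zeta>. mono_eval \<alpha>' \<zeta> * cnj (mono_eval \<beta>' \<zeta>) \<partial>M))"

text \<open>
  The infimum of real numbers is over a nonempty set bounded below, and all the integrals
  exist if \<open>M\<close> is a finite Borel measure on the sphere; see the lemmas at the end.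
\<close>

definition christoffel :: "(complex ^ 'd::finite) measure \<Rightarrow> complex ^ 'd \<Rightarrow> real" where
  "christoffel M z =
     (INF q \<in> {q :: 'd cpoly. cpoly_eval q z = 1}. \<integral>\<zeta>. (cmod (cpoly_eval q \<zeta>))\<^sup>2 \<partial>M)"

lemma sets_sphere_measure [measurable_cong]: "sets sphere_measure = sets sphere_borel"
  by (simp add: sphere_measure_def sets_restrict_space)

lemma space_sphere_measure: "space sphere_measure = sphere 0 1"
  by (simp add: sphere_measure_def space_restrict_space)

lemma emeasure_sphere_measure:
  fixes A :: "'a::euclidean_space set"
  assumes "A \<in> sets sphere_borel"
  shows "emeasure sphere_measure A =
    emeasure lborel (ball 0 1 \<inter> sgn -` A) / emeasure lborel (ball (0::'a) 1)"
proof -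
  have sub: "A \<subseteq> sphere 0 1" and A: "A \<in> sets borel"
    using assms by (auto simp: sets_restrict_space)
  have "emeasure sphere_measure A =
      emeasure (distr (uniform_measure lborel (ball (0::'a) 1)) borel sgn) A"
    unfolding sphere_measure_def by (rule emeasure_restrict_space) (use sub in auto)
  also have "\<dots> = emeasure (uniform_measure lborel (ball (0::'a) 1)) (sgn -` A)"
    using A by (subst emeasure_distr) (auto simp: uniform_measure_def)
  also have "\<dots> = emeasure lborel (ball 0 1 \<inter> sgn -` A) / emeasure lborel (ball (0::'a) 1)"
    using A measurable_sets_borel[OF borel_measurable_sgn A]
    by (subst emeasure_uniform_measure) auto
  finally show ?thesis .
qed

lemma prob_space_sphere_measure: "prob_space (sphere_measure :: 'a::euclidean_space measure)"
proof
  have ball0: "emeasure lborel (ball (0::'a) 1) \<noteq> 0"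
    using open_not_negligible[of "ball (0::'a) 1"]
    by (auto simp: negligible_iff_null_sets null_sets_def)
  have ballinf: "emeasure lborel (ball (0::'a) 1) \<noteq> \<infinity>"
    using emeasure_bounded_finite[OF bounded_ball, of "0::'a" 1] by auto
  have s: "(sphere 0 1 :: 'a set) \<in> sets sphere_borel"
    by (metis sets.top space_borel space_restrict_space Int_UNIV_right)
  have eq: "ball 0 1 \<inter> sgn -` sphere 0 1 = ball 0 1 - {0::'a}"
    by (auto simp: norm_sgn)
  have "emeasure lborel (ball 0 1 - {0::'a}) = emeasure lborel (ball (0::'a) 1)"
    by (intro emeasure_Diff_null_set) (auto simp: null_sets_def)
  then show "emeasure (sphere_measure :: 'a measure) (space sphere_measure) = 1"
    using ball0 ballinf unfolding space_sphere_measure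
    by (simp add: emeasure_sphere_measure[OF s] eq less_top)
qed

text \<open>The next lemma is the uniqueness of Haar measure, applied to the image of \<open>lborel\<close> under \<open>f\<close>.\<close>

lemma lborel_distr_orthogonal:
  fixes f :: "'a::euclidean_space \<Rightarrow> 'a"
  assumes f: "orthogonal_transformation f"
  shows "distr lborel borel f = lborel"
proof (rule measure_eqI)
  let ?N = "distr lborel borel f"
  have lin: "linear f" using f by (rule orthogonal_transformation_linear)
  have fm [measurable]: "f \<in> borel_measurable borel"
    using lin by (intro borel_measurable_continuous_onI linear_continuous_on linear_conv_bounded_linear[THEN iffD1])
  obtain g where g: "orthogonal_transformation g" "\<And>x. f (g x) = x" "\<And>x. g (f x) = x"
    using orthogonal_transformation_inv[OF f] orthogonal_transformation_bij[OF f]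
    by (metis bij_inv_eq_iff)
  have gm [measurable]: "g \<in> borel_measurable borel"
    using orthogonal_transformation_linear[OF g(1)]
    by (intro borel_measurable_continuous_onI linear_continuous_on linear_conv_bounded_linear[THEN iffD1])
  let ?B = "ball (0::'a) 1"
  have pairm: "(\<lambda>(x, y). indicator ?B (h x y) * indicator C (k x y) :: ennreal)
      \<in> borel_measurable (lborel \<Otimes>\<^sub>M lborel)"
    if "continuous_on UNIV (\<lambda>p. h (fst p) (snd p))" "continuous_on UNIV (\<lambda>p. k (fst p) (snd p))"
      and "C \<in> sets borel" for h k :: "'a \<Rightarrow> 'a \<Rightarrow> 'a" and C
  proof -
    have "(\<lambda>p. indicator ?B (h (fst p) (snd p)) :: ennreal) \<in> borel_measurable borel"
      by (rule measurable_compose[OF borel_measurable_continuous_onI[OF that(1)]])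
        (rule borel_measurable_indicator, simp)
    moreover have "(\<lambda>p. indicator C (k (fst p) (snd p)) :: ennreal) \<in> borel_measurable borel"
      by (rule measurable_compose[OF borel_measurable_continuous_onI[OF that(2)]])
        (rule borel_measurable_indicator, simp add: that(3))
    ultimately show ?thesis
      unfolding lborel_prod case_prod_beta by (intro borel_measurable_times_ennreal) simp_all
  qed
  have fcont: "continuous_on S (\<lambda>x. f (h x))"
    if "continuous_on S h" for S and h :: "'a \<times> 'a \<Rightarrow> 'a"
    using linear_continuous_on_compose[OF that lin] .
  have ball0: "emeasure lborel ?B \<noteq> 0"
    using open_not_negligible[of ?B]
    by (auto simp: negligible_iff_null_sets null_sets_def)
  have ballinf: "emeasure lborel ?B \<noteq> \<infinity>"
    using emeasure_bounded_finite[OF bounded_ball, of "0::'a" 1] by auto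
  have Bm [measurable, simp]: "(indicator ?B :: 'a \<Rightarrow> ennreal) \<in> borel_measurable borel"
    by (rule borel_measurable_indicator) simp
  have plus: "(\<integral>\<^sup>+x. h (c + x) \<partial>lborel) = (\<integral>\<^sup>+x. h x \<partial>lborel)"
    if [measurable]: "h \<in> borel_measurable borel" for h :: "'a \<Rightarrow> ennreal" and c
  proof -
    have "(\<integral>\<^sup>+x. h x \<partial>lborel) = (\<integral>\<^sup>+x. h x \<partial>distr lborel borel ((+) c))"
      by (simp add: lborel_distr_plus)
    then show ?thesis by (simp add: nn_integral_distr)
  qed
  show "sets ?N = sets (lborel :: 'a measure)" by simp
  fix A assume "A \<in> sets ?N"
  then have A [measurable]: "A \<in> sets borel" by simp
  have Am [measurable, simp]: "(indicator A :: 'a \<Rightarrow> ennreal) \<in> borel_measurable borel"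
    by (rule borel_measurable_indicator) (rule A)
  have *: "f x + y = f (g y + x)" for x y
    using lin g by (simp add: linear_add add.commute)
  have nf: "norm (f x) = norm x" for x
    by (rule orthogonal_transformation_norm[OF f])
  have "emeasure ?N A * emeasure lborel ?B =
      (\<integral>\<^sup>+y. indicator ?B y * (\<integral>\<^sup>+x. indicator A (f x) \<partial>lborel) \<partial>lborel)"
  proof -
    have "emeasure ?N A = (\<integral>\<^sup>+x. indicator A (f x) \<partial>lborel)"
      using nn_integral_distr[of f lborel borel "indicator A"] by simp
    moreover have c: "(\<integral>\<^sup>+y. indicator ?B y * c \<partial>lborel) = emeasure lborel ?B * c" for c
      by (subst nn_integral_multc) auto
    ultimately show ?thesis unfolding c by (simp add: mult.commute)
  qed
  also have "\<dots> = (\<integral>\<^sup>+y. indicator ?B y * (\<integral>\<^sup>+x. indicator A (f x + y) \<partial>lborel) \<partial>lborel)"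
    unfolding * by (subst plus) auto
  also have "\<dots> = (\<integral>\<^sup>+y. (\<integral>\<^sup>+x. indicator ?B y * indicator A (f x + y) \<partial>lborel) \<partial>lborel)"
    by (simp add: nn_integral_cmult)
  also have "\<dots> = (\<integral>\<^sup>+x. (\<integral>\<^sup>+y. indicator ?B y * indicator A (f x + y) \<partial>lborel) \<partial>lborel)"
    by (intro lborel_pair.Fubini' pairm continuous_intros fcont A)
  also have "\<dots> = (\<integral>\<^sup>+x. (\<integral>\<^sup>+y. indicator ?B (y - f x) * indicator A y \<partial>lborel) \<partial>lborel)"
  proof -
    have "(\<integral>\<^sup>+y. indicator ?B y * indicator A (f x + y) \<partial>lborel)
        = (\<integral>\<^sup>+y. indicator ?B (y - f x) * indicator A y \<partial>lborel)" for x
      using plus[of "\<lambda>y. indicator ?B (y - f x) * indicator A y" "f x"] by simp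
    then show ?thesis by (simp only:)
  qed
  also have "\<dots> = (\<integral>\<^sup>+y. (\<integral>\<^sup>+x. indicator ?B (y - f x) * indicator A y \<partial>lborel) \<partial>lborel)"
    by (intro lborel_pair.Fubini' pairm continuous_intros fcont A)
  also have "\<dots> = (\<integral>\<^sup>+y. (\<integral>\<^sup>+x. indicator ?B (f x - y) \<partial>lborel) * indicator A y \<partial>lborel)"
    by (intro nn_integral_cong)
       (simp add: nn_integral_multc indicator_def norm_minus_commute)
  also have "\<dots> = (\<integral>\<^sup>+y. (\<integral>\<^sup>+x. indicator ?B (f x) \<partial>lborel) * indicator A y \<partial>lborel)"
  proof -
    have sub: "f x - y = f (- g y + x)" for x y
      using *[of x "-y"] orthogonal_transformation_linear[OF g(1)] by (simp add: linear_neg)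
    have "(\<integral>\<^sup>+x. indicator ?B (f x - y) \<partial>lborel) = (\<integral>\<^sup>+x. indicator ?B (f x) \<partial>lborel)" for y
      using plus[of "\<lambda>x. indicator ?B (f x)" "- g y"] by (simp only: sub) simp
    then show ?thesis by (simp only:)
  qed
  also have "\<dots> = emeasure lborel ?B * emeasure lborel A"
  proof -
    have "indicator ?B (f x) = (indicator ?B x :: ennreal)" for x
      by (simp add: indicator_def nf)
    then show ?thesis by (simp add: nn_integral_cmult)
  qed
  finally have "emeasure lborel ?B * emeasure ?N A = emeasure lborel ?B * emeasure lborel A"
    by (simp add: mult.commute)
  then show "emeasure ?N A = emeasure lborel A"
    using ball0 ballinf by (simp add: ennreal_mult_cancel_left)
qed

lemma sphere_measure_rotation_invariant:
  fixes f :: "'a::euclidean_space \<Rightarrow> 'a"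
  assumes f: "orthogonal_transformation f"
  shows "distr sphere_measure sphere_measure f = sphere_measure"
proof (rule measure_eqI)
  show "sets (distr sphere_measure sphere_measure f) = sets (sphere_measure :: 'a measure)"
    by simp
  fix A assume "A \<in> sets (distr sphere_measure sphere_measure f)"
  then have A: "A \<in> sets sphere_borel" by (simp add: sets_sphere_measure)
  then have Ab: "A \<in> sets borel" by (auto simp: sets_restrict_space)
  have nf: "norm (f x) = norm x" for x
    by (rule orthogonal_transformation_norm[OF f])
  have fm: "f \<in> borel_measurable borel"
    using orthogonal_transformation_linear[OF f]
    by (intro borel_measurable_continuous_onI linear_continuous_on linear_conv_bounded_linear[THEN iffD1])
  have fs: "f \<in> measurable sphere_borel sphere_borel"
    by (rule measurable_restrict_space3[OF fm]) (auto simp: nf)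
  then have fs': "f \<in> measurable sphere_measure sphere_measure"
    by (simp add: measurable_cong_sets[OF sets_sphere_measure sets_sphere_measure])
  have fA: "f -` A \<inter> sphere 0 1 \<in> sets sphere_borel"
    using measurable_sets[OF fs A] by (simp add: space_restrict_space)
  have sg: "sgn (f x) = f (sgn x)" for x
    by (simp add: sgn_div_norm nf orthogonal_transformation_scaleR[OF f])
  have ns: "x \<in> sphere 0 1" if "x \<in> A" for x
    using A that by (auto simp: sets_restrict_space)
  have eq: "ball 0 1 \<inter> sgn -` (f -` A \<inter> sphere 0 1) = f -` (ball 0 1 \<inter> sgn -` A)"
    using ns by (auto simp: nf sg) (metis nf dist_0_norm mem_sphere)
  have m: "ball 0 1 \<inter> sgn -` A \<in> sets borel"
    using measurable_sets_borel[OF borel_measurable_sgn Ab] by auto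
  have "emeasure (distr sphere_measure sphere_measure f) A
      = emeasure sphere_measure (f -` A \<inter> sphere 0 1)"
    using A fs' by (subst emeasure_distr) (auto simp: sets_sphere_measure space_sphere_measure)
  also have "\<dots> = emeasure (distr lborel borel f) (ball 0 1 \<inter> sgn -` A)
      / emeasure lborel (ball (0::'a) 1)"
    unfolding emeasure_sphere_measure[OF fA] eq
    using m fm by (subst emeasure_distr) auto
  also have "\<dots> = emeasure sphere_measure A"
    by (simp add: lborel_distr_orthogonal[OF f] emeasure_sphere_measure[OF A])
  finally show "emeasure (distr sphere_measure sphere_measure f) A = emeasure sphere_measure A" .
qed

lemma finite_shortlex:
  "finite {\<beta> :: 'd::{finite,linorder} \<Rightarrow>\<^sub>0 nat. shortlex_le 0 \<beta> \<and> shortlex_le \<beta> \<alpha>}"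
proof -
  let ?S = "{\<beta> :: 'd \<Rightarrow>\<^sub>0 nat. shortlex_le 0 \<beta> \<and> shortlex_le \<beta> \<alpha>}"
  have "Poly_Mapping.lookup \<beta> i \<le> mdeg \<alpha>" if "\<beta> \<in> ?S" for \<beta> i
  proof -
    have "Poly_Mapping.lookup \<beta> i \<le> mdeg \<beta>" unfolding mdeg_def by (rule member_le_sum) auto
    also have "\<dots> \<le> mdeg \<alpha>" using that by (auto simp: shortlex_le_def shortlex_less_def)
    finally show ?thesis .
  qed
  then have "Poly_Mapping.lookup ` ?S \<subseteq> (UNIV :: 'd set) \<rightarrow>\<^sub>E {..mdeg \<alpha>}" by auto
  then have "finite (Poly_Mapping.lookup ` ?S)"
    by (rule finite_subset) (intro finite_PiE; simp)
  then show ?thesis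
    by (rule finite_imageD) (auto intro!: inj_onI poly_mapping_eqI)
qed

lemma continuous_on_cpoly_eval: "continuous_on S (cpoly_eval q)"
  unfolding cpoly_eval_def mono_eval_def by (intro continuous_intros)

lemma integrable_cpoly_eval:
  fixes M :: "(complex ^ 'd::finite) measure"
  assumes "finite_measure M" "sets M = sets sphere_borel"
  shows "integrable M (\<lambda>\<zeta>. (cmod (cpoly_eval q \<zeta>))\<^sup>2)"
proof -
  interpret finite_measure M by fact
  have sp: "space M = sphere 0 1"
    using sets_eq_imp_space_eq[OF assms(2)] by (simp add: space_restrict_space)
  have cont: "continuous_on S (\<lambda>\<zeta>. (cmod (cpoly_eval q \<zeta>))\<^sup>2)" for S
    by (intro continuous_intros continuous_on_cpoly_eval)
  have meas: "(\<lambda>\<zeta>. (cmod (cpoly_eval q \<zeta>))\<^sup>2) \<in> borel_measurable M"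
    using borel_measurable_continuous_on_restrict[OF cont]
    by (simp add: measurable_cong_sets[OF assms(2) refl])
  have "bounded ((\<lambda>\<zeta>. (cmod (cpoly_eval q \<zeta>))\<^sup>2) ` sphere 0 1)"
    by (intro compact_imp_bounded compact_continuous_image cont) simp
  then obtain B where "\<And>\<zeta>. \<zeta> \<in> sphere 0 1 \<Longrightarrow> norm ((cmod (cpoly_eval q \<zeta>))\<^sup>2) \<le> B"
    unfolding bounded_iff by blast
  then show ?thesis
    by (intro integrable_const_bound[where B = B] AE_I2 meas) (simp add: sp)
qed

lemma christoffel_set_nonempty: "{q :: 'd::finite cpoly. cpoly_eval q z = 1} \<noteq> {}"
proof -
  have "cpoly_eval (1 :: 'd cpoly) z = 1"
    by (simp add: cpoly_eval_def mono_eval_def)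
  then show ?thesis by blast
qed

lemma christoffel_bdd_below:
  "bdd_below ((\<lambda>q. \<integral>\<zeta>. (cmod (cpoly_eval q \<zeta>))\<^sup>2 \<partial>M) ` {q :: 'd::finite cpoly. cpoly_eval q z = 1})"
  by (intro bdd_belowI2[where m = 0] integral_nonneg) simp

end

theory Submission
  imports Defs
begin

text \<open>
  Point masses on the sphere do not affect the Christoffel function inside the ball, because every
  point \<open>c\<close> of the sphere is a peak point: the polynomial \<open>f = (1 + \<langle>z, c\<rangle>) / 2\<close> equals 1 at \<open>c\<close> and
  has modulus less than 1 everywhere else on the closed ball. Hence \<open>1 - f\<^sup>n\<close> vanishes at \<open>c\<close>, is
  bounded by 2, and tends to 1 at every other point of the closed ball. Given a competitor \<open>q\<close> with
  \<open>q(z) = 1\<close> and a finite set \<open>F\<close> in the sphere, multiply \<open>q\<close> by the product of these factors over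
  \<open>c \<in> F\<close>. At the interior point \<open>z\<close> the product tends to \<open>q(z) = 1\<close>, and by dominated convergence
  its squared \<open>L\<^sup>2\<close> norm tends to the integral of \<open>\<bar>q\<bar>\<^sup>2\<close> over the complement of \<open>F\<close>. So deleting \<open>F\<close> from
  the measure does not lower the infimum (\<open>christoffel_le_integral_minus_finite\<close>).

  The bound on the product of the factors is 2 to the number of points of \<open>F\<close>, so the argument does
  not apply to infinitely many points at once. But the inequality for finite \<open>F\<close> no longer contains
  the auxiliary factors, only \<open>q\<close> itself, and a second dominated convergence along finite sets
  increasing to a countable set \<open>C\<close> gives \<open>christoffel_minus_countable\<close>.

  If \<open>C\<close> carries the discrete singular part, then \<open>\<mu>\<close> without \<open>C\<close> is at most \<open>\<mu>ac\<close>, which is at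
  most \<open>\<mu>\<close>. Since the Christoffel function is monotone in the measure, all three values agree.
\<close>

section \<open>Evaluation of polynomials\<close>

text \<open>
  Evaluation at a point is a ring homomorphism, so the polynomials below can be built with the
  arithmetic of \<open>poly_mapping\<close> and evaluated by the simplifier.
\<close>

lemma mono_eval_add: "mono_eval (\<alpha> + \<beta>) z = mono_eval \<alpha> z * mono_eval \<beta> z"
  by (simp add: mono_eval_def lookup_add power_add prod.distrib)

lemma mono_eval_0 [simp]: "mono_eval 0 z = 1"
  by (simp add: mono_eval_def)

lemma mono_eval_single_1 [simp]: "mono_eval (Poly_Mapping.single i (Suc 0)) z = z $ i"
proof -
  have "mono_eval (Poly_Mapping.single i (Suc 0)) z = (\<Prod>j\<in>UNIV. if j = i then z $ i else 1)"
    unfolding mono_eval_def by (rule prod.cong) (auto simp: lookup_single when_def)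
  then show ?thesis by simp
qed

lemma cpoly_eval_superset:
  assumes "finite A" "Poly_Mapping.keys q \<subseteq> A"
  shows "cpoly_eval q z = (\<Sum>\<alpha>\<in>A. Poly_Mapping.lookup q \<alpha> * mono_eval \<alpha> z)"
  unfolding cpoly_eval_def using assms
  by (intro sum.mono_neutral_left) (auto simp: in_keys_iff)

lemma cpoly_eval_0 [simp]: "cpoly_eval 0 z = 0"
  by (simp add: cpoly_eval_def)

lemma cpoly_eval_single [simp]: "cpoly_eval (Poly_Mapping.single \<alpha> c) z = c * mono_eval \<alpha> z"
  by (subst cpoly_eval_superset[of "{\<alpha>}"]) (auto simp: in_keys_iff lookup_single when_def)

lemma cpoly_eval_1 [simp]: "cpoly_eval 1 z = 1"
  using cpoly_eval_single[of 0 1 z] by simp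

lemma cpoly_eval_add [simp]: "cpoly_eval (p + q) z = cpoly_eval p z + cpoly_eval q z"
proof -
  let ?A = "Poly_Mapping.keys p \<union> Poly_Mapping.keys q"
  have "cpoly_eval r z = (\<Sum>\<alpha>\<in>?A. Poly_Mapping.lookup r \<alpha> * mono_eval \<alpha> z)"
    if "r \<in> {p, q, p + q}" for r
    using that Poly_Mapping.keys_add[of p q] by (intro cpoly_eval_superset) auto
  then show ?thesis by (simp add: lookup_add distrib_right sum.distrib)
qed

lemma cpoly_eval_diff [simp]: "cpoly_eval (p - q) z = cpoly_eval p z - cpoly_eval q z"
  using cpoly_eval_add[of "p - q" q z] by simp

lemma cpoly_eval_sum [simp]: "cpoly_eval (\<Sum>i\<in>I. p i) z = (\<Sum>i\<in>I. cpoly_eval (p i) z)"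
  by (induction I rule: infinite_finite_induct) auto

lemma poly_mapping_monomial_induct [case_names zero add]:
  fixes p :: "'a \<Rightarrow>\<^sub>0 'b::comm_monoid_add"
  assumes zero: "P 0" and add: "\<And>a b q. P q \<Longrightarrow> P (Poly_Mapping.single a b + q)"
  shows "P p"
proof (induction p rule: update_induct)
  case const
  show ?case by (rule zero)
next
  case (update q a b)
  then have "Poly_Mapping.update a b q = Poly_Mapping.single a b + q"
    by (intro poly_mapping_eqI)
      (auto simp: lookup_update lookup_add lookup_single when_def in_keys_iff)
  with add[OF update.IH] show ?case by simp
qed

lemma cpoly_eval_mult [simp]: "cpoly_eval (p * q) z = cpoly_eval p z * cpoly_eval q z"
proof -
  have single: "cpoly_eval (Poly_Mapping.single \<alpha> c * q) z
      = cpoly_eval (Poly_Mapping.single \<alpha> c) z * cpoly_eval q z" for \<alpha> c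
    by (induction q rule: poly_mapping_monomial_induct)
      (simp_all add: mult_single mono_eval_add algebra_simps)
  show ?thesis
    by (induction p rule: poly_mapping_monomial_induct)
      (simp_all add: single distrib_right del: cpoly_eval_single)
qed

lemma cpoly_eval_power [simp]: "cpoly_eval (p ^ n) z = cpoly_eval p z ^ n"
  by (induction n) auto

lemma cpoly_eval_prod [simp]: "cpoly_eval (\<Prod>i\<in>I. p i) z = (\<Prod>i\<in>I. cpoly_eval (p i) z)"
  by (induction I rule: infinite_finite_induct) auto

section \<open>Every point of the sphere is a peak point of the ball\<close>

text \<open>The affine function \<open>(1 + \<langle>z, c\<rangle>) / 2\<close>, where \<open>\<langle>z, c\<rangle>\<close> is the Hermitian inner product.\<close>

definition peak_poly :: "complex ^ 'd::finite \<Rightarrow> 'd cpoly" where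
  "peak_poly c = Poly_Mapping.single 0 (1/2) +
     (\<Sum>i\<in>UNIV. Poly_Mapping.single (Poly_Mapping.single i 1) (cnj (c $ i) / 2))"

lemma cpoly_eval_peak_poly:
  "cpoly_eval (peak_poly c) z = (1 + (\<Sum>i\<in>UNIV. z $ i * cnj (c $ i))) / 2"
  by (simp add: peak_poly_def sum_divide_distrib add_divide_distrib mult.commute)

text \<open>
  For \<open>w = \<langle>z, c\<rangle>\<close>, Cauchy-Schwarz gives \<open>\<bar>w\<bar> \<le> 1\<close>, hence
  \<open>\<bar>1 + w\<bar>\<^sup>2 = 1 + 2 Re w + \<bar>w\<bar>\<^sup>2 \<le> 2 + 2 Re w\<close>; and \<open>Re w\<close> is the real inner product of \<open>z\<close> and \<open>c\<close>,
  which controls the distance from \<open>z\<close> to \<open>c\<close>.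
\<close>

lemma norm_peak_poly_le:
  fixes z c :: "complex ^ 'd::finite"
  assumes "norm z \<le> 1" "norm c = 1"
  shows "(cmod (cpoly_eval (peak_poly c) z))\<^sup>2 \<le> 1 - (dist z c)\<^sup>2 / 4"
proof -
  define w where "w = (\<Sum>i\<in>UNIV. z $ i * cnj (c $ i))"
  have "cmod w \<le> (\<Sum>i\<in>UNIV. \<bar>cmod (z $ i)\<bar> * \<bar>cmod (c $ i)\<bar>)"
    unfolding w_def by (rule sum_norm_le) (simp add: norm_mult)
  also have "\<dots> \<le> norm z * norm c"
    unfolding norm_vec_def by (rule L2_set_mult_ineq)
  finally have w: "cmod w \<le> 1" using assms by simp
  have re: "Re w = inner z c"
    by (simp add: w_def inner_vec_def inner_complex_def)
  have "(cmod (1 + w))\<^sup>2 = 1 + 2 * Re w + (cmod w)\<^sup>2"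
    unfolding cmod_power2 by (simp add: power2_eq_square algebra_simps)
  also have "\<dots> \<le> 2 + 2 * inner z c"
    using w re by (simp add: abs_square_le_1)
  also have "2 * inner z c = (norm z)\<^sup>2 + (norm c)\<^sup>2 - (dist z c)\<^sup>2"
    by (simp add: dist_norm power2_norm_eq_inner inner_diff_left inner_diff_right inner_commute)
  also have "2 + \<dots> \<le> 4 - (dist z c)\<^sup>2"
    using assms by (simp add: abs_square_le_1)
  finally show ?thesis
    by (simp add: cpoly_eval_peak_poly w_def[symmetric] norm_divide power_divide)
qed

lemma norm_peak_poly_le_1:
  assumes "norm z \<le> 1" "norm c = 1"
  shows "cmod (cpoly_eval (peak_poly c) z) \<le> 1"
proof -
  have "(cmod (cpoly_eval (peak_poly c) z))\<^sup>2 \<le> 1"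
    using norm_peak_poly_le[OF assms] zero_le_power2[of "dist z c"] by linarith
  then show ?thesis by (simp add: abs_square_le_1)
qed

lemma norm_peak_poly_less_1:
  assumes "norm z \<le> 1" "norm c = 1" "z \<noteq> c"
  shows "cmod (cpoly_eval (peak_poly c) z) < 1"
proof -
  have "(cmod (cpoly_eval (peak_poly c) z))\<^sup>2 < 1"
    using norm_peak_poly_le[OF assms(1,2)] zero_less_power2[THEN iffD2, of "dist z c"] assms(3)
    by (smt (verit) dist_eq_0_iff divide_pos_pos)
  then show ?thesis by (simp add: abs_square_less_1)
qed

lemma peak_poly_self:
  assumes "norm c = 1"
  shows "cpoly_eval (peak_poly c) c = 1"
proof -
  have "(\<Sum>i\<in>UNIV. c $ i * cnj (c $ i)) = of_real ((norm c)\<^sup>2)"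
    unfolding power2_norm_eq_inner inner_vec_def of_real_sum
    by (intro sum.cong refl) (simp add: complex_mult_cnj inner_complex_def power2_eq_square)
  then show ?thesis using assms by (simp add: cpoly_eval_peak_poly)
qed

text \<open>A polynomial vanishing on \<open>F\<close> that is close to 1 away from \<open>F\<close> when \<open>n\<close> is large.\<close>

definition notch_poly :: "(complex ^ 'd::finite) set \<Rightarrow> nat \<Rightarrow> 'd cpoly" where
  "notch_poly F n = (\<Prod>c\<in>F. 1 - peak_poly c ^ n)"

text \<open>
  Away from \<open>F\<close> the powers of the peak functions tend to 0, on \<open>F\<close> one factor vanishes.
\<close>

lemma notch_poly_tendsto:
  fixes z :: "complex ^ 'd::finite"
  assumes "finite F" "F \<subseteq> sphere 0 1" "norm z \<le> 1"
  shows "(\<lambda>n. cpoly_eval (notch_poly F n) z) \<longlonglongrightarrow> indicator (- F) z"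
proof (cases "z \<in> F")
  case True
  then have "cpoly_eval (notch_poly F n) z = 0" for n
    using assms by (auto simp: notch_poly_def peak_poly_self subset_iff intro!: prod_zero bexI[of _ z])
  then show ?thesis using True by simp
next
  case False
  have "(\<lambda>n. \<Prod>c\<in>F. 1 - cpoly_eval (peak_poly c) z ^ n) \<longlonglongrightarrow> (\<Prod>c\<in>F. 1 - 0)"
    using assms False
    by (intro tendsto_prod tendsto_diff tendsto_const LIMSEQ_power_zero norm_peak_poly_less_1)
      (auto simp: subset_iff)
  then show ?thesis using False by (simp add: notch_poly_def)
qed

text \<open>Uniformity in \<open>n\<close> is what allows dominated convergence.\<close>

lemma norm_notch_poly_le:
  assumes "F \<subseteq> sphere 0 1" "norm z \<le> 1"
  shows "cmod (cpoly_eval (notch_poly F n) z) \<le> 2 ^ card F"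
proof -
  have "cmod (1 - cpoly_eval (peak_poly c) z ^ n) \<le> 2" if "c \<in> F" for c
  proof -
    have "cmod (cpoly_eval (peak_poly c) z ^ n) \<le> 1"
      using norm_peak_poly_le_1[of z c] assms that by (auto simp: norm_power subset_iff intro!: power_le_one)
    then show ?thesis
      using norm_triangle_ineq4[of 1 "cpoly_eval (peak_poly c) z ^ n"] by simp
  qed
  then have "(\<Prod>c\<in>F. cmod (1 - cpoly_eval (peak_poly c) z ^ n)) \<le> (\<Prod>c\<in>F. 2)"
    by (intro prod_mono) auto
  then show ?thesis by (simp add: notch_poly_def flip: prod_norm)
qed

section \<open>Christoffel functions\<close>

lemma christoffel_le:
  assumes "cpoly_eval q z = 1"
  shows "christoffel M z \<le> (\<integral>\<zeta>. (cmod (cpoly_eval q \<zeta>))\<^sup>2 \<partial>M)"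
  unfolding christoffel_def using assms by (intro cINF_lower christoffel_bdd_below) simp

lemma christoffel_greatest:
  assumes "\<And>q. cpoly_eval q z = 1 \<Longrightarrow> b \<le> (\<integral>\<zeta>. (cmod (cpoly_eval q \<zeta>))\<^sup>2 \<partial>M)"
  shows "b \<le> christoffel M z"
  unfolding christoffel_def using assms by (intro cINF_greatest christoffel_set_nonempty) simp

text \<open>
  The homogeneous form of the extremal property. It spares the division by the values at \<open>z\<close> of the
  approximating polynomials below, which only tend to 1.
\<close>

lemma christoffel_mult_le:
  "christoffel M z * (cmod (cpoly_eval p z))\<^sup>2 \<le> (\<integral>\<zeta>. (cmod (cpoly_eval p \<zeta>))\<^sup>2 \<partial>M)"
proof (cases "cpoly_eval p z = 0")
  case True
  then show ?thesis by (simp add: integral_nonneg)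
next
  case False
  let ?a = "cpoly_eval p z"
  have "christoffel M z \<le> (\<integral>\<zeta>. (cmod (cpoly_eval (Poly_Mapping.single 0 (1 / ?a) * p) \<zeta>))\<^sup>2 \<partial>M)"
    using False by (intro christoffel_le) simp
  also have "\<dots> = (\<integral>\<zeta>. (cmod (cpoly_eval p \<zeta>))\<^sup>2 \<partial>M) / (cmod ?a)\<^sup>2"
    by (simp add: norm_divide power_divide)
  finally show ?thesis using False by (simp add: field_simps)
qed

lemma christoffel_mono_measure:
  fixes M N :: "(complex ^ 'd::finite) measure"
  assumes "finite_measure N" and N: "sets N = sets sphere_borel" and M: "sets M = sets sphere_borel"
    and le: "\<And>A. A \<in> sets sphere_borel \<Longrightarrow> emeasure M A \<le> emeasure N A"
  shows "christoffel M z \<le> christoffel N z"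
proof (rule christoffel_greatest)
  fix q :: "'d cpoly" assume q: "cpoly_eval q z = 1"
  interpret N: finite_measure N by fact
  have sp: "space M = space N" using M N by (intro sets_eq_imp_space_eq) simp
  have "emeasure M (space M) \<le> emeasure N (space N)"
    using le[of "space M"] M sp by (metis sets.top)
  then have "finite_measure M"
    by (intro finite_measureI) (auto simp: top_unique)
  have iM: "integrable M (\<lambda>\<zeta>. (cmod (cpoly_eval q \<zeta>))\<^sup>2)"
    by (rule integrable_cpoly_eval) fact+
  have iN: "integrable N (\<lambda>\<zeta>. (cmod (cpoly_eval q \<zeta>))\<^sup>2)"
    by (rule integrable_cpoly_eval) fact+
  have "M \<le> N"
    using M N le sp by (intro le_measure[THEN iffD2]) (auto simp: le_fun_def)
  then have "(\<integral>\<^sup>+\<zeta>. (cmod (cpoly_eval q \<zeta>))\<^sup>2 \<partial>M) \<le> (\<integral>\<^sup>+\<zeta>. (cmod (cpoly_eval q \<zeta>))\<^sup>2 \<partial>N)"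
    using M N iM by (intro nn_integral_mono_measure) auto
  then have "(\<integral>\<zeta>. (cmod (cpoly_eval q \<zeta>))\<^sup>2 \<partial>M) \<le> (\<integral>\<zeta>. (cmod (cpoly_eval q \<zeta>))\<^sup>2 \<partial>N)"
    using iM iN by (simp add: nn_integral_eq_integral)
  with christoffel_le[OF q, of M]
  show "christoffel M z \<le> (\<integral>\<zeta>. (cmod (cpoly_eval q \<zeta>))\<^sup>2 \<partial>N)" by linarith
qed

section \<open>Deleting countably many points\<close>

text \<open>
  Apply the homogeneous inequality to \<open>q\<close> times the polynomials vanishing on \<open>F\<close> and let
  \<open>n \<rightarrow> \<infinity>\<close>: the left side tends to \<open>christoffel M z\<close> because \<open>z\<close> lies in the open ball, hence outside
  \<open>F\<close>; the right side loses exactly the contribution of \<open>F\<close>.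
\<close>

lemma christoffel_le_integral_minus_finite:
  fixes M :: "(complex ^ 'd::finite) measure"
  assumes M: "finite_measure M" "sets M = sets sphere_borel"
    and F: "finite F" "F \<subseteq> sphere 0 1"
    and z: "z \<in> ball 0 1" and q: "cpoly_eval q z = 1"
  shows "christoffel M z \<le> (\<integral>\<zeta>. indicator (- F) \<zeta> * (cmod (cpoly_eval q \<zeta>))\<^sup>2 \<partial>M)"
proof -
  let ?p = "\<lambda>n. q * notch_poly F n"
  let ?b = "\<lambda>\<zeta>. ((2 ^ card F)\<^sup>2 :: real) * (cmod (cpoly_eval q \<zeta>))\<^sup>2"
  have sp: "space M = sphere 0 1"
    using sets_eq_imp_space_eq[OF M(2)] by (simp add: space_restrict_space)
  have meas: "(\<lambda>\<zeta>. (cmod (cpoly_eval p \<zeta>))\<^sup>2) \<in> borel_measurable M" for p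
    using integrable_cpoly_eval[OF M] by (rule borel_measurable_integrable)
  have Fb: "- F \<in> sets borel"
    using F by (intro borel_open) (simp add: finite_imp_closed open_Compl)
  have Fm: "(indicator (- F) :: _ \<Rightarrow> real) \<in> borel_measurable M"
    using Fb by (simp add: measurable_cong_sets[OF M(2) refl] measurable_restrict_space1)
  have lim: "(\<lambda>n. (cmod (cpoly_eval (?p n) \<zeta>))\<^sup>2) \<longlonglongrightarrow> indicator (- F) \<zeta> * (cmod (cpoly_eval q \<zeta>))\<^sup>2"
    if "norm \<zeta> \<le> 1" for \<zeta>
  proof -
    have "(\<lambda>n. (cmod (cpoly_eval q \<zeta> * cpoly_eval (notch_poly F n) \<zeta>))\<^sup>2)
        \<longlonglongrightarrow> (cmod (cpoly_eval q \<zeta> * indicator (- F) \<zeta>))\<^sup>2"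
      by (intro tendsto_intros notch_poly_tendsto F that)
    then show ?thesis by (cases "\<zeta> \<in> F") (simp_all add: norm_mult)
  qed
  have "(\<lambda>n. christoffel M z * (cmod (cpoly_eval (?p n) z))\<^sup>2)
      \<longlonglongrightarrow> christoffel M z * (indicator (- F) z * (cmod (cpoly_eval q z))\<^sup>2)"
    using z by (intro tendsto_mult_left lim) simp
  moreover have "z \<notin> F" using z F by auto
  ultimately have "(\<lambda>n. christoffel M z * (cmod (cpoly_eval (?p n) z))\<^sup>2) \<longlonglongrightarrow> christoffel M z"
    by (simp only: q) simp
  moreover have "(\<lambda>n. \<integral>\<zeta>. (cmod (cpoly_eval (?p n) \<zeta>))\<^sup>2 \<partial>M)
      \<longlonglongrightarrow> (\<integral>\<zeta>. indicator (- F) \<zeta> * (cmod (cpoly_eval q \<zeta>))\<^sup>2 \<partial>M)"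
  proof (rule integral_dominated_convergence[where w = ?b])
    show "integrable M ?b" by (intro integrable_mult_right integrable_cpoly_eval M)
    show "AE \<zeta> in M. norm ((cmod (cpoly_eval (?p n) \<zeta>))\<^sup>2) \<le> ?b \<zeta>" for n
    proof (rule AE_I2)
      fix \<zeta> assume "\<zeta> \<in> space M"
      then have "cmod (cpoly_eval (notch_poly F n) \<zeta>) \<le> 2 ^ card F"
        using F by (intro norm_notch_poly_le) (auto simp: sp)
      then have "(cmod (cpoly_eval (notch_poly F n) \<zeta>))\<^sup>2 * (cmod (cpoly_eval q \<zeta>))\<^sup>2
          \<le> (2 ^ card F)\<^sup>2 * (cmod (cpoly_eval q \<zeta>))\<^sup>2"
        by (intro mult_right_mono power_mono) auto
      then show "norm ((cmod (cpoly_eval (?p n) \<zeta>))\<^sup>2) \<le> ?b \<zeta>"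
        by (simp add: norm_mult power_mult_distrib mult.commute)
    qed
  qed (use Fm meas lim in \<open>auto simp: sp simp del: cpoly_eval_mult\<close>)
  ultimately show ?thesis
    by (rule LIMSEQ_le) (blast intro: christoffel_mult_le)
qed

text \<open>
  The finite sets exhaust \<open>C\<close>, and \<open>\<bar>q\<bar>\<^sup>2\<close> dominates all the integrands.
\<close>

theorem christoffel_minus_countable:
  fixes M :: "(complex ^ 'd::finite) measure"
  assumes M: "finite_measure M" "sets M = sets sphere_borel"
    and C: "countable C" "C \<subseteq> sphere 0 1"
    and z: "z \<in> ball 0 1"
  shows "christoffel M z \<le> christoffel (density M (indicator (- C))) z"
proof (rule christoffel_greatest)
  fix q :: "'d cpoly" assume q: "cpoly_eval q z = 1"
  let ?g = "\<lambda>\<zeta>. (cmod (cpoly_eval q \<zeta>))\<^sup>2"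
  \<comment> \<open>The intersection with \<open>C\<close> matters for empty \<open>C\<close> only, where \<open>from_nat_into\<close> is arbitrary.\<close>
  define F where "F n = C \<inter> from_nat_into C ` {..<n}" for n
  have F: "finite (F n)" "F n \<subseteq> sphere 0 1" for n
    using C by (auto simp: F_def)
  have g: "integrable M ?g" by (rule integrable_cpoly_eval[OF M])
  have ind: "(indicator (- D) :: _ \<Rightarrow> real) \<in> borel_measurable M" if "countable D" for D
  proof -
    have "D \<in> sets borel" by (rule sets.countable[OF _ that]) simp
    then have "- D \<in> sets borel" by (rule borel_comp)
    then show ?thesis by (simp add: measurable_cong_sets[OF M(2) refl] measurable_restrict_space1)
  qed
  have lim: "(\<lambda>n. indicator (- F n) \<zeta> * ?g \<zeta>) \<longlonglongrightarrow> indicator (- C) \<zeta> * ?g \<zeta>" for \<zeta>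
  proof (rule tendsto_eventually, cases "\<zeta> \<in> C")
    case True
    then obtain m where "\<zeta> = from_nat_into C m"
      using from_nat_into_surj[OF C(1)] by metis
    then have "indicator (- F n) \<zeta> = (indicator (- C) \<zeta> :: real)" if "n > m" for n
      using True that by (auto simp: F_def indicator_def)
    then show "\<forall>\<^sub>F n in sequentially. indicator (- F n) \<zeta> * ?g \<zeta> = indicator (- C) \<zeta> * ?g \<zeta>"
      by (intro eventually_mono[OF eventually_gt_at_top[of m]]) simp
  qed (auto simp: F_def)
  have "(\<lambda>n. \<integral>\<zeta>. indicator (- F n) \<zeta> * ?g \<zeta> \<partial>M) \<longlonglongrightarrow> (\<integral>\<zeta>. indicator (- C) \<zeta> * ?g \<zeta> \<partial>M)"
  proof (rule integral_dominated_convergence[where w = ?g])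
    show "(\<lambda>\<zeta>. indicator (- C) \<zeta> * ?g \<zeta>) \<in> borel_measurable M"
      by (intro borel_measurable_times ind C borel_measurable_integrable[OF g])
    show "(\<lambda>\<zeta>. indicator (- F n) \<zeta> * ?g \<zeta>) \<in> borel_measurable M" for n
      by (intro borel_measurable_times ind countable_finite F borel_measurable_integrable[OF g])
    show "AE \<zeta> in M. norm (indicator (- F n) \<zeta> * ?g \<zeta>) \<le> ?g \<zeta>" for n
      by (intro AE_I2) (simp add: indicator_def)
  qed (use g lim in simp_all)
  then have "christoffel M z \<le> (\<integral>\<zeta>. indicator (- C) \<zeta> * ?g \<zeta> \<partial>M)"
    by (rule LIMSEQ_le_const) (blast intro: christoffel_le_integral_minus_finite[OF M F z q])
  also have "\<dots> = (\<integral>\<zeta>. ?g \<zeta> \<partial>density M (\<lambda>\<zeta>. ennreal (indicator (- C) \<zeta>)))"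
    using g ind[OF C(1)] by (subst integral_density) auto
  finally show "christoffel M z \<le> (\<integral>\<zeta>. ?g \<zeta> \<partial>density M (indicator (- C)))"
    by (simp add: ennreal_indicator)
qed

section \<open>Discrete singular parts\<close>

theorem theorem5p6:
  fixes \<mu> \<mu>ac \<mu>s :: "(complex ^ 'd::{finite,linorder}) measure"
  assumes "prob_space \<mu>"
    and "sets \<mu> = sets sphere_borel"
    and "nontrivial_measure \<mu>"
    and "lebesgue_decomposition sphere_measure \<mu> \<mu>ac \<mu>s"
    and "discrete_measure \<mu>s"
  shows "\<forall>z0 \<in> ball 0 1. christoffel \<mu> z0 = christoffel \<mu>ac z0"
proof
  fix z0 :: "complex ^ 'd::{finite,linorder}" assume z0: "z0 \<in> ball 0 1"
  interpret prob_space \<mu> by fact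
  note S = assms(2)
  have Sac: "sets \<mu>ac = sets sphere_borel" and Ss: "sets \<mu>s = sets sphere_borel"
    and split: "\<And>A. A \<in> sets sphere_borel \<Longrightarrow> emeasure \<mu> A = emeasure \<mu>ac A + emeasure \<mu>s A"
    using assms(4) by (auto simp: lebesgue_decomposition_def sets_sphere_measure)
  have sp: "space \<mu> = sphere 0 1" "space \<mu>s = sphere 0 1"
    using sets_eq_imp_space_eq[OF S] sets_eq_imp_space_eq[OF Ss] by (simp_all add: space_restrict_space)
  obtain \<rho> :: "nat \<Rightarrow> real" and \<zeta> where \<zeta>: "\<And>k. \<zeta> k \<in> sphere 0 1"
    and \<mu>s: "\<And>A. A \<in> sets sphere_borel \<Longrightarrow>
      emeasure \<mu>s A = suminf (\<lambda>k. ennreal (\<rho> k) * indicator A (\<zeta> k))"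
    using assms(5) unfolding discrete_measure_def Ss sp by blast
  let ?C = "range \<zeta>"
  have C: "- ?C \<in> sets borel" by (rule borel_comp, rule sets.countable) auto
  have fin: "finite_measure \<mu>ac"
  proof
    have "emeasure \<mu>ac (space \<mu>ac) \<le> emeasure \<mu> (space \<mu>)"
      using split[of "space \<mu>ac"] Sac S
      by (metis le_iff_add sets.top sets_eq_imp_space_eq)
    then show "emeasure \<mu>ac (space \<mu>ac) \<noteq> \<infinity>" by (auto simp: top_unique)
  qed
  have le_ac: "emeasure (density \<mu> (indicator (- ?C))) A \<le> emeasure \<mu>ac A"
    if A: "A \<in> sets sphere_borel" for A
  proof -
    obtain A' where "A' \<in> sets borel" "A = sphere 0 1 \<inter> A'"
      using A unfolding sets_restrict_space by blast
    then have B: "A \<inter> - ?C \<in> sets sphere_borel"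
      unfolding sets_restrict_space using C by (intro image_eqI[of _ _ "A' \<inter> - ?C"]) auto
    have "(indicator (- ?C) :: _ \<Rightarrow> ennreal) \<in> borel_measurable \<mu>"
      using C by (simp add: measurable_cong_sets[OF S refl] measurable_restrict_space1)
    then have "emeasure (density \<mu> (indicator (- ?C))) A
        = (\<integral>\<^sup>+x. indicator (- ?C) x * indicator A x \<partial>\<mu>)"
      using A S by (intro emeasure_density) simp_all
    also have "\<dots> = (\<integral>\<^sup>+x. indicator (A \<inter> - ?C) x \<partial>\<mu>)"
      by (simp only: indicator_inter_arith mult.commute)
    also have "\<dots> = emeasure \<mu> (A \<inter> - ?C)"
      using B S by (intro nn_integral_indicator) simp
    \<comment> \<open>Every term of the series for \<open>\<mu>s\<close> vanishes on a set that avoids all the \<open>\<zeta> k\<close>.\<close>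
    also have "\<dots> = emeasure \<mu>ac (A \<inter> - ?C)"
      using split[OF B] \<mu>s[OF B] by simp
    also have "\<dots> \<le> emeasure \<mu>ac A"
      using A Sac by (intro emeasure_mono) auto
    finally show ?thesis .
  qed
  have "christoffel \<mu> z0 \<le> christoffel (density \<mu> (indicator (- ?C))) z0"
    using \<zeta> S z0 by (intro christoffel_minus_countable) (auto simp: finite_measure_axioms)
  also have "\<dots> \<le> christoffel \<mu>ac z0"
    by (rule christoffel_mono_measure) (use fin S Sac le_ac in auto)
  finally have "christoffel \<mu> z0 \<le> christoffel \<mu>ac z0" .
  moreover have "christoffel \<mu>ac z0 \<le> christoffel \<mu> z0"
    by (rule christoffel_mono_measure) (use S Sac split finite_measure_axioms in auto)
  ultimately show "christoffel \<mu> z0 = christoffel \<mu>ac z0" by simp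
qed

end
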